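(* Let $\mathcal{K}(\mathbb{M}_2)\cong\mathbb{R}^6$ be the space of Killing $2$-tensors of the Minkowski plane with coordinates $(A,B,C,\alpha,\beta,\gamma)$, and let $G_M$, $R_0$, $R_1$, $S_1$, $S_2$ and $\Gamma_1,\dots,\Gamma_8$ be as defined in the context. All the sets $\Gamma_1,\dots,\Gamma_8$ are connected, and hence the set $\mathcal{K}(\mathbb{M}_2)\setminus(S_1\cup S_2)$ has $8$ connected components. This set consists of exactly three orbits of the action of $G_M$: $\Gamma_1\cup\Gamma_5$ and $\Gamma_4\cup\Gamma_8$ (in both cases the two components are linked by the transformation $R_0$), and $\Gamma_2\cup\Gamma_3\cup\Gamma_6\cup\Gamma_7$ (whose components are linked by $R_0$ and $R_1$).
   Context: In the Minkowski plane $\mathbb{M}_2$ with pseudo-Cartesian coordinates $(t,x)$ and metric $\mathbf{g}$ with contravariant components $\mathrm{diag}(1,-1)$, the general Killing $2$-tensor has contravariant components $K^{11}=A+2\alpha x+\gamma x^2$, $K^{12}=K^{21}=C+\alpha t+\beta x+\gamma tx$, $K^{22}=B+2\beta t+\gamma t^2$, with $A,B,C,\alpha,\beta,\gamma\in\mathbb{R}$. So the vector space $\mathcal{K}(\mathbb{M}_2)$ of Killing $2$-tensors is identified with $\mathbb{R}^6$ with coordinates $(A,B,C,\alpha,\beta,\gamma)$. With respect to $(\partial_A,\partial_B,\partial_C,\partial_\alpha,\partial_\beta,\partial_\gamma)$ define the vector fields on $\mathcal{K}(\mathbb{M}_2)$: $V_1=(0,-2\beta,-\alpha,0,-\gamma,0)$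 and $V_2=(-2\alpha,0,-\beta,-\gamma,0,0)$ (translations); $V_3=(2C,2C,A+B,\beta,\alpha,0)$ (boost); $V_4=(2A,2B,2C,\alpha,\beta,0)$ (dilatation of the plane); $V_5=(1,-1,0,0,0,0)$ (addition of a multiple of the metric); $V_6=(A,B,C,\alpha,\beta,\gamma)$ (scalar multiplication). Discrete transformations of $\mathcal{K}(\mathbb{M}_2)$ (unlisted coordinates are unchanged): $R_0:\mathbf{K}\mapsto-\mathbf{K}$; $R_1: C\mapsto-C,\ \alpha\mapsto-\alpha$; $R_2: C\mapsto-C,\ \beta\mapsto-\beta$. $G_M$ is the group of transformations of $\mathcal{K}(\mathbb{M}_2)$ generated by the flows of $V_1,\dots,V_6$ and by $R_0,R_1,R_2$. Two sets are "linked" by a set of discrete transformations if one is mapped onto the other by some composition of them. Put $Z_+=\gamma(A+B-2C)-(\alpha-\beta)^2$ and $Z_-=\gamma(A+B+2C)-(\alpha+\beta)^2$. $S_1=\{\gamma=0\}$; $S_2=\{Z_+Z_-=0\}$. The sets $\Gamma_1,\dots,\Gamma_8$ partition $\mathcal{K}(\mathbb{M}_2)\setminus(S_1\cup S_2)$ according to the signs of $(\gamma,Z_+,Z_-)$: $\Gamma_1:(+,+,+)$, $\Gamma_2:(+,+,-)$, $\Gamma_3:(+,-,+)$, $\Gamma_4:(+,-,-)$, $\Gamma_5:(-,+,+)$, $\Gamma_6:(-,+,-)$, $\Gamma_7:(-,-,+)$, $\Gamma_8:(-,-,-)$. *)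

theory Defs
  imports "HOL-Analysis.Analysis" "HOL-Algebra.Group_Action" "HOL-Algebra.Generated_Groups"
begin

text \<open>
  A Killing 2-tensor of the Minkowski plane, with contravariant components
    K11 = A + 2 \<alpha> x + \<gamma> x^2,  K12 = K21 = C + \<alpha> t + \<beta> x + \<gamma> t x,  K22 = B + 2 \<beta> t + \<gamma> t^2
  in pseudo-Cartesian coordinates (t, x), is identified with its parameter tuple
  (A, B, C, \<alpha>, \<beta>, \<gamma>).
\<close>

type_synonym killing = "real \<times> real \<times> real \<times> real \<times> real \<times> real"

fun V1 :: "killing \<Rightarrow> killing" where
  "V1 (A, B, C, \<alpha>, \<beta>, \<gamma>) = (0, - 2 * \<beta>, - \<alpha>, 0, - \<gamma>, 0)"

fun V2 :: "killing \<Rightarrow> killing" where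
  "V2 (A, B, C, \<alpha>, \<beta>, \<gamma>) = (- 2 * \<alpha>, 0, - \<beta>, - \<gamma>, 0, 0)"

fun V3 :: "killing \<Rightarrow> killing" where
  "V3 (A, B, C, \<alpha>, \<beta>, \<gamma>) = (2 * C, 2 * C, A + B, \<beta>, \<alpha>, 0)"

fun V4 :: "killing \<Rightarrow> killing" where
  "V4 (A, B, C, \<alpha>, \<beta>, \<gamma>) = (2 * A, 2 * B, 2 * C, \<alpha>, \<beta>, 0)"

fun V5 :: "killing \<Rightarrow> killing" where
  "V5 (A, B, C, \<alpha>, \<beta>, \<gamma>) = (1, - 1, 0, 0, 0, 0)"

fun V6 :: "killing \<Rightarrow> killing" where
  "V6 (A, B, C, \<alpha>, \<beta>, \<gamma>) = (A, B, C, \<alpha>, \<beta>, \<gamma>)"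

fun R0 :: "killing \<Rightarrow> killing" where
  "R0 (A, B, C, \<alpha>, \<beta>, \<gamma>) = (- A, - B, - C, - \<alpha>, - \<beta>, - \<gamma>)"

fun R1 :: "killing \<Rightarrow> killing" where
  "R1 (A, B, C, \<alpha>, \<beta>, \<gamma>) = (A, B, - C, - \<alpha>, \<beta>, \<gamma>)"

fun R2 :: "killing \<Rightarrow> killing" where
  "R2 (A, B, C, \<alpha>, \<beta>, \<gamma>) = (A, B, - C, \<alpha>, - \<beta>, \<gamma>)"

text \<open>Global flows suffice, since every vector field above is affine and hence complete.\<close>

definition is_flow :: "('a::real_normed_vector \<Rightarrow> 'a) \<Rightarrow> (real \<Rightarrow> 'a \<Rightarrow> 'a) \<Rightarrow> bool" where
  "is_flow V \<Phi> \<longleftrightarrow>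
     (\<forall>K. \<Phi> 0 K = K \<and> (\<forall>s. ((\<lambda>r. \<Phi> r K) has_vector_derivative V (\<Phi> s K)) (at s)))"

definition GM_generators :: "(killing \<Rightarrow> killing) set" where
  "GM_generators =
     {\<Phi> s | V \<Phi> s. V \<in> {V1, V2, V3, V4, V5, V6} \<and> is_flow V \<Phi>} \<union> {R0, R1, R2}"

definition GM :: "(killing \<Rightarrow> killing) monoid" where
  "GM = (BijGroup UNIV)\<lparr>carrier := generate (BijGroup UNIV) GM_generators\<rparr>"

definition linked :: "('a \<Rightarrow> 'a) set \<Rightarrow> 'a set \<Rightarrow> 'a set \<Rightarrow> bool" where
  "linked D X Y \<longleftrightarrow> (\<exists>Ts. set Ts \<subseteq> D \<and> foldr comp Ts id ` X = Y)"

fun gam :: "killing \<Rightarrow> real" where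
  "gam (A, B, C, \<alpha>, \<beta>, \<gamma>) = \<gamma>"

fun Zp :: "killing \<Rightarrow> real" where
  "Zp (A, B, C, \<alpha>, \<beta>, \<gamma>) = \<gamma> * (A + B - 2 * C) - (\<alpha> - \<beta>)\<^sup>2"

fun Zm :: "killing \<Rightarrow> real" where
  "Zm (A, B, C, \<alpha>, \<beta>, \<gamma>) = \<gamma> * (A + B + 2 * C) - (\<alpha> + \<beta>)\<^sup>2"

definition S1 :: "killing set" where
  "S1 = {K. gam K = 0}"

definition S2 :: "killing set" where
  "S2 = {K. Zp K * Zm K = 0}"

text \<open>Only the indices 1 to 8 are meaningful in the following definition.\<close>

definition \<Gamma> :: "nat \<Rightarrow> killing set" where
  "\<Gamma> i = {K. (sgn (gam K), sgn (Zp K), sgn (Zm K)) =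
     [(1, 1, 1), (1, 1, -1), (1, -1, 1), (1, -1, -1),
      (-1, 1, 1), (-1, 1, -1), (-1, -1, 1), (-1, -1, -1)] ! (i - 1)}"

end

theory Submission
  imports Defs
begin

text \<open>
  The idea is to read everything off the three functions \<open>\<gamma>\<close>, \<open>Z\<^sub>+\<close> and \<open>Z\<^sub>-\<close>.

  \<^emph>\<open>Topology.\<close> Where \<open>\<gamma> \<noteq> 0\<close>, the relation
  \<open>Z\<^sub>\<plusminus> = \<gamma> (A + B \<mp> 2 C) - (\<alpha> \<mp> \<beta>)\<^sup>2\<close> can be solved for \<open>A + B \<mp> 2 C\<close>, so that
  \<open>(\<gamma>, Z\<^sub>+, Z\<^sub>-, \<alpha>, \<beta>, A - B)\<close> are global coordinates (\<open>chart_coordinates\<close>). In these coordinates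
  a set with prescribed signs of \<open>\<gamma>\<close>, \<open>Z\<^sub>+\<close> and \<open>Z\<^sub>-\<close> is a product of half-lines and lines,
  hence convex and connected; it is also open, so these sets are the components.

  \<^emph>\<open>Orbits, upper bound.\<close> The two translations and the addition of the metric leave \<open>\<gamma>\<close>,
  \<open>Z\<^sub>+\<close> and \<open>Z\<^sub>-\<close> fixed, the boost, the dilatation and the scalar multiplication multiply them by
  positive factors, \<open>R\<^sub>0\<close> changes only the sign of \<open>\<gamma>\<close>, while \<open>R\<^sub>1\<close> and \<open>R\<^sub>2\<close> exchange
  \<open>Z\<^sub>+\<close> with \<open>Z\<^sub>-\<close>. So \<open>G\<^sub>M\<close> preserves the condition \<open>\<gamma> \<noteq> 0\<close> and the unordered pair of
  signs of \<open>Z\<^sub>+\<close> and \<open>Z\<^sub>-\<close> (\<open>GM_sign_pair\<close>).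

  \<^emph>\<open>Orbits, lower bound.\<close> If \<open>\<gamma> \<noteq> 0\<close>, translations remove \<open>\<alpha>\<close> and \<open>\<beta>\<close>, adding a multiple
  of the metric makes \<open>A = B\<close>, and \<open>\<gamma>\<close> is scaled to \<open>1\<close>, after \<open>R\<^sub>0\<close> if
  it is negative. What remains is a tensor determined by its two values \<open>Z\<^sub>\<plusminus>\<close>. Boost and dilatation rescale these independently, down
  to their signs, and \<open>R\<^sub>1\<close> exchanges them (\<open>orbit_GM\<close>). Three unordered pairs of nonzero
  signs exist, hence three orbits.

  The group is generated by all flows of the fields rather than by given formulas. Because
  the fields are affine, a Gronwall estimate makes integral curves unique
  (\<open>integral_curve_unique\<close>); therefore each flow is the explicit one, and the group law of
  flows makes every generator a bijection.
\<close>

section \<open>Flows of affine vector fields\<close>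

text \<open>
  The squared distance \<open>w\<close> of two integral curves satisfies \<open>\<bar>w'\<bar> \<le> 2 M w\<close>, where \<open>M\<close> is a
  Lipschitz constant of the field, so \<open>exp (-2 M s) * w s\<close> decreases and \<open>exp (2 M s) * w s\<close>
  increases; the first pins \<open>w\<close> down for \<open>s \<ge> 0\<close>, the second for \<open>s \<le> 0\<close>.
\<close>

lemma integral_curve_unique:
  fixes V :: "'a::euclidean_space \<Rightarrow> 'a" and x y :: "real \<Rightarrow> 'a"
  assumes affine: "linear (\<lambda>v. V v - V 0)"
    and x: "\<And>s. (x has_vector_derivative V (x s)) (at s)"
    and y: "\<And>s. (y has_vector_derivative V (y s)) (at s)"
    and init: "x 0 = y 0"
  shows "x = y"
proof
  fix s :: real
  obtain M where M: "\<And>v. norm (V v - V 0) \<le> M * norm v"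
    using linear_bounded_pos[OF affine] by blast
  have lip: "norm (V u - V v) \<le> M * norm (u - v)" for u v
    using M[of "u - v"] linear_diff[OF affine, of u v] by simp
  define w where "w r = (x r - y r) \<bullet> (x r - y r)" for r
  define w' where "w' r = 2 * ((x r - y r) \<bullet> (V (x r) - V (y r)))" for r
  have "((\<lambda>r. x r - y r) has_vector_derivative (V (x r) - V (y r))) (at r)" for r
    by (rule has_vector_derivative_diff[OF x y])
  from bounded_bilinear.has_vector_derivative[OF bounded_bilinear_inner this this]
  have w: "(w has_real_derivative w' r) (at r)" for r
    unfolding w_def[abs_def] w'_def has_real_derivative_iff_has_vector_derivative
    by (simp add: inner_commute)
  have bound: "\<bar>w' r\<bar> \<le> 2 * M * w r" for r
  proof -
    have "\<bar>w' r\<bar> \<le> 2 * (norm (x r - y r) * norm (V (x r) - V (y r)))"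
      using Cauchy_Schwarz_ineq2[of "x r - y r" "V (x r) - V (y r)"] by (simp add: w'_def abs_mult)
    also have "\<dots> \<le> 2 * (norm (x r - y r) * (M * norm (x r - y r)))"
      using lip by (intro mult_left_mono) auto
    also have "\<dots> = 2 * M * w r"
      by (simp add: w_def dot_square_norm power2_eq_square)
    finally show ?thesis .
  qed
  have "w s \<le> 0"
  proof (cases "s \<ge> 0")
    case True
    have "w s * exp (- (2 * M * s)) \<le> w 0 * exp (- (2 * M * 0))"
    proof (rule DERIV_nonpos_imp_nonincreasing[OF True])
      fix r
      have "((\<lambda>r. w r * exp (- (2 * M * r))) has_real_derivative
          (w' r - 2 * M * w r) * exp (- (2 * M * r))) (at r)"
        by (rule derivative_eq_intros w refl | simp add: algebra_simps)+
      moreover have "(w' r - 2 * M * w r) * exp (- (2 * M * r)) \<le> 0"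
        using bound[of r] by (intro mult_nonpos_nonneg) auto
      ultimately show "\<exists>d. ((\<lambda>r. w r * exp (- (2 * M * r))) has_real_derivative d) (at r) \<and> d \<le> 0"
        by blast
    qed
    then show ?thesis by (simp add: w_def init mult_le_0_iff)
  next
    case False
    then have "s \<le> 0" by simp
    have "w s * exp (2 * M * s) \<le> w 0 * exp (2 * M * 0)"
    proof (rule DERIV_nonneg_imp_nondecreasing[OF \<open>s \<le> 0\<close>])
      fix r
      have "((\<lambda>r. w r * exp (2 * M * r)) has_real_derivative
          (w' r + 2 * M * w r) * exp (2 * M * r)) (at r)"
        by (rule derivative_eq_intros w refl | simp add: algebra_simps)+
      moreover have "0 \<le> (w' r + 2 * M * w r) * exp (2 * M * r)"
        using bound[of r] by (intro mult_nonneg_nonneg) auto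
      ultimately show "\<exists>d. ((\<lambda>r. w r * exp (2 * M * r)) has_real_derivative d) (at r) \<and> 0 \<le> d"
        by blast
    qed
    then show ?thesis by (simp add: w_def init mult_le_0_iff)
  qed
  then have "(x s - y s) \<bullet> (x s - y s) = 0"
    by (intro antisym) (auto simp: w_def)
  then show "x s = y s" by simp
qed

lemma flow_unique:
  fixes V :: "'a::euclidean_space \<Rightarrow> 'a"
  assumes "linear (\<lambda>v. V v - V 0)" "is_flow V \<Phi>" "is_flow V \<Psi>"
  shows "\<Phi> = \<Psi>"
proof -
  have "(\<lambda>s. \<Phi> s K) = (\<lambda>s. \<Psi> s K)" for K
    by (rule integral_curve_unique[OF assms(1)]) (use assms(2,3) in \<open>auto simp: is_flow_def\<close>)
  then show ?thesis by (metis ext)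
qed

text \<open>
  Shifting the time of an integral curve of an autonomous field gives an integral curve again,
  so both sides are integral curves in \<open>t\<close> that start at \<open>\<Phi> s K\<close>.
\<close>

lemma flow_add:
  fixes V :: "'a::euclidean_space \<Rightarrow> 'a"
  assumes "linear (\<lambda>v. V v - V 0)" "is_flow V \<Phi>"
  shows "\<Phi> t (\<Phi> s K) = \<Phi> (t + s) K"
proof -
  have "((\<lambda>r. \<Phi> (r + s) K) has_vector_derivative V (\<Phi> (r + s) K)) (at r)" for r
  proof -
    have "((\<lambda>r. r + s) has_vector_derivative 1) (at r)"
      by (auto intro!: derivative_eq_intros)
    moreover have "((\<lambda>r. \<Phi> r K) has_vector_derivative V (\<Phi> (r + s) K)) (at (r + s))"
      using assms(2) by (auto simp: is_flow_def)
    ultimately show ?thesis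
      using vector_diff_chain_at by (fastforce simp: o_def)
  qed
  then have "(\<lambda>r. \<Phi> r (\<Phi> s K)) = (\<lambda>r. \<Phi> (r + s) K)"
    using assms(2) by (intro integral_curve_unique[OF assms(1)]) (auto simp: is_flow_def)
  then show ?thesis by metis
qed

lemma flow_bij:
  fixes V :: "'a::euclidean_space \<Rightarrow> 'a"
  assumes "linear (\<lambda>v. V v - V 0)" "is_flow V \<Phi>"
  shows "bij (\<Phi> s)"
proof (rule o_bij)
  have "\<Phi> 0 K = K" for K using assms(2) by (simp add: is_flow_def)
  then show "\<Phi> (- s) \<circ> \<Phi> s = id" "\<Phi> s \<circ> \<Phi> (- s) = id"
    by (auto simp: flow_add[OF assms] fun_eq_iff)
qed

section \<open>The flows on Killing tensors in closed form\<close>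

fun translation1 :: "real \<Rightarrow> killing \<Rightarrow> killing" where
  "translation1 s (A, B, C, \<alpha>, \<beta>, \<gamma>) =
     (A, B - 2 * \<beta> * s + \<gamma> * s\<^sup>2, C - \<alpha> * s, \<alpha>, \<beta> - \<gamma> * s, \<gamma>)"

fun translation2 :: "real \<Rightarrow> killing \<Rightarrow> killing" where
  "translation2 s (A, B, C, \<alpha>, \<beta>, \<gamma>) =
     (A - 2 * \<alpha> * s + \<gamma> * s\<^sup>2, B, C - \<beta> * s, \<alpha> - \<gamma> * s, \<beta>, \<gamma>)"

text \<open>
  The boost is diagonal in light-cone components: \<open>A + B \<plusminus> 2 C\<close> has the weight \<open>\<plusminus>2\<close>,
  \<open>\<alpha> \<plusminus> \<beta>\<close> the weight \<open>\<plusminus>1\<close>, and \<open>A - B\<close> and \<open>\<gamma>\<close> are invariant.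
\<close>

fun boost :: "real \<Rightarrow> killing \<Rightarrow> killing" where
  "boost s (A, B, C, \<alpha>, \<beta>, \<gamma>) =
     ((A - B) / 2 + ((A + B + 2 * C) * exp (2 * s) + (A + B - 2 * C) * exp (- 2 * s)) / 4,
      (B - A) / 2 + ((A + B + 2 * C) * exp (2 * s) + (A + B - 2 * C) * exp (- 2 * s)) / 4,
      ((A + B + 2 * C) * exp (2 * s) - (A + B - 2 * C) * exp (- 2 * s)) / 4,
      ((\<alpha> + \<beta>) * exp s + (\<alpha> - \<beta>) * exp (- s)) / 2,
      ((\<alpha> + \<beta>) * exp s - (\<alpha> - \<beta>) * exp (- s)) / 2,
      \<gamma>)"

fun dilatation :: "real \<Rightarrow> killing \<Rightarrow> killing" where
  "dilatation s (A, B, C, \<alpha>, \<beta>, \<gamma>) =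
     (A * exp (2 * s), B * exp (2 * s), C * exp (2 * s), \<alpha> * exp s, \<beta> * exp s, \<gamma>)"

fun add_metric :: "real \<Rightarrow> killing \<Rightarrow> killing" where
  "add_metric s (A, B, C, \<alpha>, \<beta>, \<gamma>) = (A + s, B - s, C, \<alpha>, \<beta>, \<gamma>)"

fun scaling :: "real \<Rightarrow> killing \<Rightarrow> killing" where
  "scaling s (A, B, C, \<alpha>, \<beta>, \<gamma>) =
     (A * exp s, B * exp s, C * exp s, \<alpha> * exp s, \<beta> * exp s, \<gamma> * exp s)"

lemmas closed_flow_simps =
  translation1.simps translation2.simps boost.simps dilatation.simps add_metric.simps scaling.simps

lemma exp_double_minus: "exp (- (2 * s)) = (exp (- s))\<^sup>2" for s :: real
  using exp_double[of "- s"] by simp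

lemma has_vector_derivative_killing:
  assumes "(a has_real_derivative a') (at s)" "(b has_real_derivative b') (at s)"
    "(c has_real_derivative c') (at s)" "(d has_real_derivative d') (at s)"
    "(e has_real_derivative e') (at s)" "(f has_real_derivative f') (at s)"
  shows "((\<lambda>r. (a r, b r, c r, d r, e r, f r)) has_vector_derivative (a', b', c', d', e', f')) (at s)"
  using assms unfolding has_real_derivative_iff_has_vector_derivative
  by (intro has_vector_derivative_Pair)

lemma closed_flows:
  "is_flow V1 translation1" "is_flow V2 translation2" "is_flow V3 boost"
  "is_flow V4 dilatation" "is_flow V5 add_metric" "is_flow V6 scaling"
  unfolding is_flow_def split_paired_All closed_flow_simps
    V1.simps V2.simps V3.simps V4.simps V5.simps V6.simps
  by (intro allI conjI has_vector_derivative_killing;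
      (auto intro!: derivative_eq_intros simp: algebra_simps add_divide_distrib diff_divide_distrib; fail))+

lemma fields_affine:
  assumes "V \<in> {V1, V2, V3, V4, V5, V6}"
  shows "linear (\<lambda>K. V K - V 0)"
  using assms
  by (auto intro!: linearI simp: zero_prod_def algebra_simps)

text \<open>
  Uniqueness of flows turns the quantification over all flows of a field into a closed form, so that
  invariance under the group becomes a computation.
\<close>

lemma GM_generators_closed:
  "GM_generators = range translation1 \<union> range translation2 \<union> range boost \<union> range dilatation
     \<union> range add_metric \<union> range scaling \<union> {R0, R1, R2}"
proof -
  have "is_flow V1 \<Phi> \<longleftrightarrow> \<Phi> = translation1" "is_flow V2 \<Phi> \<longleftrightarrow> \<Phi> = translation2"
    "is_flow V3 \<Phi> \<longleftrightarrow> \<Phi> = boost" "is_flow V4 \<Phi> \<longleftrightarrow> \<Phi> = dilatation"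
    "is_flow V5 \<Phi> \<longleftrightarrow> \<Phi> = add_metric" "is_flow V6 \<Phi> \<longleftrightarrow> \<Phi> = scaling" for \<Phi>
    using closed_flows flow_unique fields_affine by blast+
  then have "(\<exists>V\<in>{V1, V2, V3, V4, V5, V6}. is_flow V \<Phi>)
      \<longleftrightarrow> \<Phi> \<in> {translation1, translation2, boost, dilatation, add_metric, scaling}" for \<Phi>
    by simp
  then have flows: "{\<Phi>. \<exists>V\<in>{V1, V2, V3, V4, V5, V6}. is_flow V \<Phi>}
      = {translation1, translation2, boost, dilatation, add_metric, scaling}"
    by blast
  have union: "{\<Phi> s | V \<Phi> s. V \<in> F \<and> is_flow V \<Phi>} = (\<Union>\<Phi>\<in>{\<Phi>. \<exists>V\<in>F. is_flow V \<Phi>}. range \<Phi>)"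
    for F :: "(killing \<Rightarrow> killing) set"
    by blast
  show ?thesis
    unfolding GM_generators_def union flows by auto
qed

lemma reflections_involutive: "R0 (R0 K) = K" "R1 (R1 K) = K" "R2 (R2 K) = K"
  by (cases K; simp)+

lemma generator_bij:
  assumes "g \<in> GM_generators"
  shows "bij g"
proof -
  have "bij R0" "bij R1" "bij R2"
    by (auto intro!: involuntory_imp_bij reflections_involutive)
  then show ?thesis
    using assms flow_bij fields_affine unfolding GM_generators_def by blast
qed

section \<open>The signs of the invariants under the group\<close>

lemma invariants_translation1 [simp]:
  "gam (translation1 s K) = gam K" "Zp (translation1 s K) = Zp K" "Zm (translation1 s K) = Zm K"
  by (cases K; simp add: algebra_simps power2_eq_square)+

lemma invariants_translation2 [simp]:
  "gam (translation2 s K) = gam K" "Zp (translation2 s K) = Zp K" "Zm (translation2 s K) = Zm K"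
  by (cases K; simp add: algebra_simps power2_eq_square)+

lemma invariants_boost [simp]:
  "gam (boost s K) = gam K" "Zp (boost s K) = exp (- (2 * s)) * Zp K"
  "Zm (boost s K) = exp (2 * s) * Zm K"
proof -
  obtain A B C \<alpha> \<beta> \<gamma> where K: "K = (A, B, C, \<alpha>, \<beta>, \<gamma>)" by (cases K)
  define u v where "u = exp s" and "v = exp (- s)"
  define P M where "P = (A + B + 2 * C) * u\<^sup>2" and "M = (A + B - 2 * C) * v\<^sup>2"
  define p m where "p = (\<alpha> + \<beta>) * u" and "m = (\<alpha> - \<beta>) * v"
  have L: "boost s K = ((A - B) / 2 + (P + M) / 4, (B - A) / 2 + (P + M) / 4, (P - M) / 4,
      (p + m) / 2, (p - m) / 2, \<gamma>)"
    by (simp add: K P_def M_def p_def m_def u_def v_def exp_double exp_double_minus)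
  have light_cone:
    "(A - B) / 2 + (P + M) / 4 + ((B - A) / 2 + (P + M) / 4) - 2 * ((P - M) / 4) = M"
    "(A - B) / 2 + (P + M) / 4 + ((B - A) / 2 + (P + M) / 4) + 2 * ((P - M) / 4) = P"
    "(p + m) / 2 - (p - m) / 2 = m" "(p + m) / 2 + (p - m) / 2 = p"
    by (simp_all add: field_simps)
  show "gam (boost s K) = gam K" by (simp add: K)
  show "Zp (boost s K) = exp (- (2 * s)) * Zp K"
    unfolding L Zp.simps light_cone unfolding K Zp.simps M_def m_def v_def exp_double_minus power_mult_distrib
    by (simp add: algebra_simps)
  show "Zm (boost s K) = exp (2 * s) * Zm K"
    unfolding L Zm.simps light_cone unfolding K Zm.simps P_def p_def u_def exp_double power_mult_distrib
    by (simp add: algebra_simps)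
qed

lemma invariants_dilatation [simp]:
  "gam (dilatation s K) = gam K" "Zp (dilatation s K) = exp (2 * s) * Zp K"
  "Zm (dilatation s K) = exp (2 * s) * Zm K"
  by (cases K; simp only: dilatation.simps gam.simps Zp.simps Zm.simps exp_double;
      simp add: algebra_simps power2_eq_square)+

lemma invariants_add_metric [simp]:
  "gam (add_metric s K) = gam K" "Zp (add_metric s K) = Zp K" "Zm (add_metric s K) = Zm K"
  by (cases K; simp)+

lemma invariants_scaling [simp]:
  "gam (scaling s K) = exp s * gam K" "Zp (scaling s K) = exp (2 * s) * Zp K"
  "Zm (scaling s K) = exp (2 * s) * Zm K"
  by (cases K; simp only: scaling.simps gam.simps Zp.simps Zm.simps exp_double;
      simp add: algebra_simps power2_eq_square)+

lemma invariants_R0 [simp]: "gam (R0 K) = - gam K" "Zp (R0 K) = Zp K" "Zm (R0 K) = Zm K"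
  by (cases K; simp add: algebra_simps power2_eq_square)+

lemma invariants_R1 [simp]: "gam (R1 K) = gam K" "Zp (R1 K) = Zm K" "Zm (R1 K) = Zp K"
  by (cases K; simp add: algebra_simps power2_eq_square)+

lemma invariants_R2 [simp]: "gam (R2 K) = gam K" "Zp (R2 K) = Zm K" "Zm (R2 K) = Zp K"
  by (cases K; simp add: algebra_simps power2_eq_square)+

text \<open>
  The two signs form an unordered pair because \<open>R\<^sub>1\<close> and \<open>R\<^sub>2\<close> exchange \<open>Z\<^sub>+\<close> and \<open>Z\<^sub>-\<close>; the
  sign of \<open>\<gamma>\<close> is forgotten because \<open>R\<^sub>0\<close> flips it.
\<close>

definition sign_pair :: "killing \<Rightarrow> bool \<times> real set" where
  "sign_pair K = (gam K = 0, {sgn (Zp K), sgn (Zm K)})"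

lemma generator_sign_pair:
  assumes "g \<in> GM_generators"
  shows "sign_pair (g K) = sign_pair K"
  using assms unfolding GM_generators_closed sign_pair_def
  by (auto simp: sgn_mult)

lemma generators_subset: "GM_generators \<subseteq> carrier (BijGroup UNIV)"
  using generator_bij by (auto simp: BijGroup_def Bij_def)

lemma GM_sign_pair:
  assumes "g \<in> carrier GM"
  shows "sign_pair (g K) = sign_pair K"
proof -
  interpret B: group "BijGroup (UNIV :: killing set)" by (rule group_BijGroup)
  have "g \<in> generate (BijGroup UNIV) GM_generators" using assms by (simp add: GM_def)
  then show ?thesis
  proof (induction arbitrary: K)
    case one
    then show ?case by (simp add: BijGroup_def)
  next
    case (incl h)
    then show ?case by (rule generator_sign_pair)
  next
    case (inv h)
    then have h: "h \<in> Bij UNIV" using generator_bij by (auto simp: Bij_def)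
    \<comment> \<open>Invariance under \<open>h\<close>, read at the preimage of \<open>K\<close>, is invariance under the inverse.\<close>
    have "sign_pair (inv_into UNIV h K) = sign_pair (h (inv_into UNIV h K))"
      by (rule generator_sign_pair[OF inv, symmetric])
    also have "h (inv_into UNIV h K) = K"
      by (rule surj_f_inv_f[OF bij_is_surj[OF generator_bij[OF inv]]])
    finally show ?case by (simp add: inv_BijGroup[OF h])
  next
    case (eng h1 h2)
    have "h1 \<in> Bij UNIV" "h2 \<in> Bij UNIV"
      using eng.hyps[THEN B.generate_in_carrier[OF generators_subset]] by (simp_all add: BijGroup_def)
    then have "(h1 \<otimes>\<^bsub>BijGroup UNIV\<^esub> h2) K = h1 (h2 K)"
      by (simp add: BijGroup_def compose_def)
    then show ?case by (simp only: eng.IH)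
  qed
qed

section \<open>Normal forms and orbits\<close>

interpretation GM: group_action GM "UNIV :: killing set" "\<lambda>g. g"
proof -
  interpret B: group "BijGroup (UNIV :: killing set)" by (rule group_BijGroup)
  have "group_hom GM (BijGroup UNIV) id"
    unfolding GM_def
    by (intro B.canonical_inj_is_hom B.generate_is_subgroup generators_subset)
  then show "group_action GM (UNIV :: killing set) (\<lambda>g. g)"
    by (simp add: group_action_def id_def)
qed

abbreviation GM_orbit :: "killing \<Rightarrow> killing set" where
  "GM_orbit \<equiv> orbit GM (\<lambda>g. g)"

lemma generator_orbit: "g \<in> GM_generators \<Longrightarrow> g K \<in> GM_orbit K"
  unfolding orbit_def GM_def by (auto intro: generate.incl)

lemma GM_orbit_trans: "L \<in> GM_orbit K \<Longrightarrow> N \<in> GM_orbit L \<Longrightarrow> N \<in> GM_orbit K"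
  by (rule GM.orbit_trans) auto

lemma GM_orbit_sym: "L \<in> GM_orbit K \<Longrightarrow> K \<in> GM_orbit L"
  by (rule GM.orbit_sym) auto

lemma GM_orbit_step: "g \<in> GM_generators \<Longrightarrow> L \<in> GM_orbit K \<Longrightarrow> g L \<in> GM_orbit K"
  using generator_orbit GM_orbit_trans by blast

lemma closed_flows_in_GM_generators:
  "translation1 s \<in> GM_generators" "translation2 s \<in> GM_generators" "boost s \<in> GM_generators"
  "dilatation s \<in> GM_generators" "add_metric s \<in> GM_generators" "scaling s \<in> GM_generators"
  by (simp_all add: GM_generators_closed)

text \<open>
  Each rule fixes its flow, so that backward chaining peels off exactly the outermost map; the
  conclusion \<open>g L\<close> of \<open>GM_orbit_step\<close> with unknown \<open>g\<close> would unify with any tensor.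
\<close>

lemmas GM_orbit_flow = closed_flows_in_GM_generators[THEN GM_orbit_step]

text \<open>
  The tensor with \<open>\<alpha> = \<beta> = 0\<close>, \<open>A = B\<close> and \<open>\<gamma> = 1\<close> whose invariants \<open>Z\<^sub>+\<close> and \<open>Z\<^sub>-\<close> are
  \<open>p\<close> and \<open>m\<close>.
\<close>

definition normal_form :: "real \<Rightarrow> real \<Rightarrow> killing" where
  "normal_form p m = ((p + m) / 4, (p + m) / 4, (m - p) / 4, 0, 0, 1)"

lemma invariants_normal_form [simp]:
  "gam (normal_form p m) = 1" "Zp (normal_form p m) = p" "Zm (normal_form p m) = m"
  by (simp_all add: normal_form_def field_simps)

text \<open>
  The translations by \<open>\<beta> / \<gamma>\<close> and \<open>\<alpha> / \<gamma>\<close> complete the squares in the components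
  \<open>B + 2 \<beta> t + \<gamma> t\<^sup>2\<close> and \<open>A + 2 \<alpha> x + \<gamma> x\<^sup>2\<close>. The divisor
  \<open>\<gamma>\<^sup>2\<close> is the effect on \<open>Z\<^sub>\<plusminus>\<close>, quadratic in the tensor, of scaling it by \<open>1 / \<gamma>\<close>.
\<close>

lemma reduce_positive_gam:
  assumes "gam K > 0"
  shows "normal_form (Zp K / (gam K)\<^sup>2) (Zm K / (gam K)\<^sup>2) \<in> GM_orbit K"
proof -
  obtain A B C \<alpha> \<beta> \<gamma> where K: "K = (A, B, C, \<alpha>, \<beta>, \<gamma>)" by (cases K)
  have "\<gamma> > 0" using assms K by simp
  define A' B' C' where "A' = A - \<alpha>\<^sup>2 / \<gamma>" and "B' = B - \<beta>\<^sup>2 / \<gamma>" and "C' = C - \<alpha> * \<beta> / \<gamma>"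
  have square: "c - 2 * x * (x / \<gamma>) + \<gamma> * (x / \<gamma>)\<^sup>2 = c - x\<^sup>2 / \<gamma>" for c x
    using \<open>\<gamma> > 0\<close> by (simp add: field_simps power2_eq_square)
  have "(A', B', C', 0, 0, \<gamma>) = translation2 (\<alpha> / \<gamma>) (translation1 (\<beta> / \<gamma>) K)"
    unfolding K translation1.simps translation2.simps square A'_def B'_def C'_def
    using \<open>\<gamma> > 0\<close> by simp
  also have "\<dots> \<in> GM_orbit K"
    by (intro GM_orbit_flow GM.orbit_refl) simp
  finally have reduced: "scaling (- ln \<gamma>) (add_metric ((B' - A') / 2) (A', B', C', 0, 0, \<gamma>))
      \<in> GM_orbit K"
    by (intro GM_orbit_flow)
  have inverse: "exp (- ln \<gamma>) = 1 / \<gamma>"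
    using \<open>\<gamma> > 0\<close> by (simp add: exp_minus inverse_eq_divide)
  have "(A' + (B' - A') / 2) * (1 / \<gamma>) = ((A' + B' - 2 * C') / \<gamma> + (A' + B' + 2 * C') / \<gamma>) / 4"
    "(B' - (B' - A') / 2) * (1 / \<gamma>) = ((A' + B' - 2 * C') / \<gamma> + (A' + B' + 2 * C') / \<gamma>) / 4"
    "C' * (1 / \<gamma>) = ((A' + B' + 2 * C') / \<gamma> - (A' + B' - 2 * C') / \<gamma>) / 4"
    "0 * (1 / \<gamma>) = 0" "\<gamma> * (1 / \<gamma>) = 1"
    using \<open>\<gamma> > 0\<close> by (simp_all add: field_simps)
  then have "scaling (- ln \<gamma>) (add_metric ((B' - A') / 2) (A', B', C', 0, 0, \<gamma>))
      = normal_form ((A' + B' - 2 * C') / \<gamma>) ((A' + B' + 2 * C') / \<gamma>)"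
    unfolding scaling.simps add_metric.simps normal_form_def inverse by (simp only:)
  also have "A' + B' - 2 * C' = Zp K / \<gamma>"
    using \<open>\<gamma> > 0\<close> by (simp add: K A'_def B'_def C'_def field_simps power2_eq_square)
  also have "A' + B' + 2 * C' = Zm K / \<gamma>"
    using \<open>\<gamma> > 0\<close> by (simp add: K A'_def B'_def C'_def field_simps power2_eq_square)
  also have "normal_form (Zp K / \<gamma> / \<gamma>) (Zm K / \<gamma> / \<gamma>)
      = normal_form (Zp K / (gam K)\<^sup>2) (Zm K / (gam K)\<^sup>2)"
    by (simp add: K power2_eq_square)
  finally show ?thesis using reduced by (simp only:)
qed

lemma reduce_to_normal_form:
  assumes "gam K \<noteq> 0"
  shows "normal_form (Zp K / (gam K)\<^sup>2) (Zm K / (gam K)\<^sup>2) \<in> GM_orbit K"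
proof (cases "gam K > 0")
  case True
  then show ?thesis by (rule reduce_positive_gam)
next
  case False
  then have "normal_form (Zp K / (gam K)\<^sup>2) (Zm K / (gam K)\<^sup>2) \<in> GM_orbit (R0 K)"
    using reduce_positive_gam[of "R0 K"] assms by simp
  moreover have "R0 K \<in> GM_orbit K"
    by (rule generator_orbit) (simp add: GM_generators_def)
  ultimately show ?thesis by (rule GM_orbit_trans[rotated])
qed

text \<open>
  A boost by \<open>s\<close> followed by a dilatation by \<open>t\<close> multiplies \<open>Z\<^sub>+\<close> by \<open>exp (2 (t - s))\<close> and \<open>Z\<^sub>-\<close>
  by \<open>exp (2 (t + s))\<close>, so both absolute values can be normalised to \<open>1\<close> at once.
\<close>

lemma normalise_absolute_values:
  assumes "p \<noteq> 0" "m \<noteq> 0"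
  shows "normal_form (sgn p) (sgn m) \<in> GM_orbit (normal_form p m)"
proof -
  \<comment> \<open>The solution of \<open>2 (t - s) = - ln \<bar>p\<bar>\<close> and \<open>2 (t + s) = - ln \<bar>m\<bar>\<close>.\<close>
  define s t where "s = (ln \<bar>p\<bar> - ln \<bar>m\<bar>) / 4" and "t = - (ln \<bar>p\<bar> + ln \<bar>m\<bar>) / 4"
  have p: "exp (- 2 * s) * exp (2 * t) = 1 / \<bar>p\<bar>"
  proof -
    have "- 2 * s + 2 * t = - ln \<bar>p\<bar>" by (simp add: s_def t_def field_simps)
    then have "exp (- 2 * s) * exp (2 * t) = exp (- ln \<bar>p\<bar>)" by (simp only: exp_add[symmetric])
    then show ?thesis using assms by (simp only:) (simp add: exp_minus inverse_eq_divide)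
  qed
  have m: "exp (2 * s) * exp (2 * t) = 1 / \<bar>m\<bar>"
  proof -
    have "2 * s + 2 * t = - ln \<bar>m\<bar>" by (simp add: s_def t_def field_simps)
    then have "exp (2 * s) * exp (2 * t) = exp (- ln \<bar>m\<bar>)" by (simp only: exp_add[symmetric])
    then show ?thesis using assms by (simp only:) (simp add: exp_minus inverse_eq_divide)
  qed
  have "dilatation t (boost s (normal_form p m)) =
    normal_form (p * (exp (- 2 * s) * exp (2 * t))) (m * (exp (2 * s) * exp (2 * t)))"
    by (simp add: normal_form_def field_simps)
  also have "\<dots> = normal_form (sgn p) (sgn m)"
    using assms by (simp only: p m) (simp add: sgn_if abs_if)
  finally have "normal_form (sgn p) (sgn m) = dilatation t (boost s (normal_form p m))" ..
  also have "\<dots> \<in> GM_orbit (normal_form p m)"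
    by (intro GM_orbit_flow GM.orbit_refl) simp
  finally show ?thesis .
qed

lemma normal_form_swap: "normal_form m p \<in> GM_orbit (normal_form p m)"
proof -
  have "normal_form m p = R1 (normal_form p m)" by (simp add: normal_form_def field_simps)
  then show ?thesis using generator_orbit[of R1] by (simp add: GM_generators_def)
qed

lemma sign_normal_form:
  assumes "K \<notin> S1 \<union> S2"
  shows "normal_form (sgn (Zp K)) (sgn (Zm K)) \<in> GM_orbit K"
proof -
  have nz: "gam K \<noteq> 0" "Zp K \<noteq> 0" "Zm K \<noteq> 0" using assms by (auto simp: S1_def S2_def)
  then have "normal_form (sgn (Zp K / (gam K)\<^sup>2)) (sgn (Zm K / (gam K)\<^sup>2)) \<in> GM_orbit K"
    by (intro GM_orbit_trans[OF reduce_to_normal_form normalise_absolute_values]) auto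
  moreover have "sgn ((gam K)\<^sup>2) = 1"
    by (rule sgn_pos) (simp add: nz)
  then have "sgn (z / (gam K)\<^sup>2) = sgn z" for z
    by (simp only: sgn_divide div_by_1)
  ultimately show ?thesis by simp
qed

text \<open>
  Two tensors with the same unordered pair of signs share a normal form up to the exchange of its
  two entries, which a reflection realises.
\<close>

lemma orbit_GM:
  assumes K: "K \<notin> S1 \<union> S2"
  shows "GM_orbit K = {L. sign_pair L = sign_pair K}"
proof (intro equalityI subsetI)
  fix L assume "L \<in> GM_orbit K"
  then show "L \<in> {L. sign_pair L = sign_pair K}"
    by (auto simp: orbit_def GM_sign_pair)
next
  fix L assume "L \<in> {L. sign_pair L = sign_pair K}"
  then have zero: "gam L = 0 \<longleftrightarrow> gam K = 0"
    and pair: "{sgn (Zp L), sgn (Zm L)} = {sgn (Zp K), sgn (Zm K)}"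
    by (auto simp: sign_pair_def)
  have "0 \<notin> {sgn (Zp L), sgn (Zm L)}"
    unfolding pair using K by (auto simp: S2_def sgn_0_0)
  then have L: "L \<notin> S1 \<union> S2"
    using K zero by (auto simp: S1_def S2_def)
  have "normal_form (sgn (Zp L)) (sgn (Zm L)) \<in> GM_orbit K"
    using pair sign_normal_form[OF K] GM_orbit_trans[OF sign_normal_form[OF K] normal_form_swap]
    by (auto simp: doubleton_eq_iff)
  then show "L \<in> GM_orbit K"
    using GM_orbit_sym[OF sign_normal_form[OF L]] GM_orbit_trans by blast
qed

section \<open>Sign sectors\<close>

definition sector :: "real \<Rightarrow> real \<Rightarrow> real \<Rightarrow> killing set" where
  "sector a b c = {K. sgn (gam K) = a \<and> sgn (Zp K) = b \<and> sgn (Zm K) = c}"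

text \<open>
  The tensor with coordinates \<open>(\<gamma>, Z\<^sub>+, Z\<^sub>-, \<alpha>, \<beta>, A - B) = (g, p, m, \<alpha>, \<beta>, d)\<close>; the two fractions
  are the values of \<open>A + B - 2 C\<close> and \<open>A + B + 2 C\<close> that these enforce.
\<close>

fun chart :: "real \<times> real \<times> real \<times> real \<times> real \<times> real \<Rightarrow> killing" where
  "chart (g, p, m, \<alpha>, \<beta>, d) =
     (let u = (p + (\<alpha> - \<beta>)\<^sup>2) / g; v = (m + (\<alpha> + \<beta>)\<^sup>2) / g
      in ((u + v) / 4 + d / 2, (u + v) / 4 - d / 2, (v - u) / 4, \<alpha>, \<beta>, g))"

lemma chart_coordinates:
  assumes "gam K \<noteq> 0"
  obtains w where "K = chart (gam K, Zp K, Zm K, w)"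
proof -
  obtain A B C \<alpha> \<beta> \<gamma> where K: "K = (A, B, C, \<alpha>, \<beta>, \<gamma>)" by (cases K)
  have "(Zp K + (\<alpha> - \<beta>)\<^sup>2) / \<gamma> = A + B - 2 * C" "(Zm K + (\<alpha> + \<beta>)\<^sup>2) / \<gamma> = A + B + 2 * C"
    using assms by (simp_all add: K)
  then have "chart (gam K, Zp K, Zm K, \<alpha>, \<beta>, A - B) =
    ((A + B - 2 * C + (A + B + 2 * C)) / 4 + (A - B) / 2,
     (A + B - 2 * C + (A + B + 2 * C)) / 4 - (A - B) / 2,
     (A + B + 2 * C - (A + B - 2 * C)) / 4, \<alpha>, \<beta>, \<gamma>)"
    by (simp only: chart.simps Let_def) (simp add: K)
  also have "\<dots> = K" by (simp add: K field_simps)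
  finally show ?thesis using that by metis
qed

lemma chart_invariants:
  assumes "g \<noteq> 0"
  shows "gam (chart (g, p, m, w)) = g" "Zp (chart (g, p, m, w)) = p" "Zm (chart (g, p, m, w)) = m"
proof -
  obtain \<alpha> \<beta> d where w: "w = (\<alpha>, \<beta>, d)" by (cases w)
  define u v where u: "u = (p + (\<alpha> - \<beta>)\<^sup>2) / g" and v: "v = (m + (\<alpha> + \<beta>)\<^sup>2) / g"
  have c: "chart (g, p, m, w) = ((u + v) / 4 + d / 2, (u + v) / 4 - d / 2, (v - u) / 4, \<alpha>, \<beta>, g)"
    by (simp add: w u v Let_def)
  have "(u + v) / 4 + d / 2 + ((u + v) / 4 - d / 2) - 2 * ((v - u) / 4) = u"
    "(u + v) / 4 + d / 2 + ((u + v) / 4 - d / 2) + 2 * ((v - u) / 4) = v"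
    by (simp_all add: field_simps)
  then show "gam (chart (g, p, m, w)) = g" "Zp (chart (g, p, m, w)) = p"
    "Zm (chart (g, p, m, w)) = m"
    unfolding c gam.simps Zp.simps Zm.simps using assms by (simp_all only:) (simp_all add: u v)
qed

lemma sector_eq_chart_image:
  assumes "a \<noteq> 0"
  shows "sector a b c = chart ` ({g. sgn g = a} \<times> {p. sgn p = b} \<times> {m. sgn m = c} \<times> UNIV)"
proof (intro equalityI subsetI)
  fix K assume K: "K \<in> sector a b c"
  then have "gam K \<noteq> 0" using assms by (auto simp: sector_def)
  then obtain w where "K = chart (gam K, Zp K, Zm K, w)" by (rule chart_coordinates)
  moreover have "(gam K, Zp K, Zm K, w) \<in> {g. sgn g = a} \<times> {p. sgn p = b} \<times> {m. sgn m = c} \<times> UNIV"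
    using K by (simp add: sector_def)
  ultimately show "K \<in> chart ` ({g. sgn g = a} \<times> {p. sgn p = b} \<times> {m. sgn m = c} \<times> UNIV)"
    by (rule image_eqI)
next
  fix K assume "K \<in> chart ` ({g. sgn g = a} \<times> {p. sgn p = b} \<times> {m. sgn m = c} \<times> UNIV)"
  then obtain g p m w where gpm: "sgn g = a" "sgn p = b" "sgn m = c" "K = chart (g, p, m, w)"
    by blast
  moreover have "g \<noteq> 0" using gpm assms by auto
  ultimately show "K \<in> sector a b c" by (simp add: sector_def chart_invariants)
qed

lemma convex_sgn: "convex {x :: real. sgn x = a}"
proof -
  consider "a = 0" | "a = 1" | "a = - 1" | "a \<notin> {0, 1, - 1}" by blast
  then show ?thesis
  proof cases
    case 1
    then have "{x. sgn x = a} = {0}" by (auto simp: sgn_0_0)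
    then show ?thesis by simp
  next
    case 2
    then have "{x. sgn x = a} = {0<..}" by (auto simp: sgn_1_pos)
    then show ?thesis by simp
  next
    case 3
    then have "{x. sgn x = a} = {..<0}" by (auto simp: sgn_1_neg)
    then show ?thesis by simp
  next
    case 4
    have "sgn x \<in> {0, 1, - 1}" for x :: real by (simp add: sgn_if)
    with 4 have "{x. sgn x = a} = {}" by blast
    then show ?thesis by simp
  qed
qed

text \<open>
  In the coordinates of \<open>chart\<close> a sector is a product of convex sets; \<open>chart\<close> is continuous on it
  because \<open>\<gamma>\<close>, the only denominator, has a nonzero sign.
\<close>

lemma connected_sector:
  assumes "a \<noteq> 0"
  shows "connected (sector a b c)"
proof -
  let ?Q = "{g. sgn g = a} \<times> {p. sgn p = b} \<times> {m. sgn m = c} \<times> (UNIV :: (real \<times> real \<times> real) set)"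
  have eq: "chart = (\<lambda>x. let g = fst x; p = fst (snd x); m = fst (snd (snd x));
        \<alpha> = fst (snd (snd (snd x))); \<beta> = fst (snd (snd (snd (snd x))));
        d = snd (snd (snd (snd (snd x))));
        u = (p + (\<alpha> - \<beta>)\<^sup>2) / g; v = (m + (\<alpha> + \<beta>)\<^sup>2) / g
      in ((u + v) / 4 + d / 2, (u + v) / 4 - d / 2, (v - u) / 4, \<alpha>, \<beta>, g))"
    by (auto simp: Let_def)
  have "continuous_on ?Q chart"
    unfolding eq Let_def using assms by (intro continuous_intros) auto
  moreover have "connected ?Q"
    by (intro convex_connected convex_Times convex_sgn convex_UNIV)
  ultimately show ?thesis
    unfolding sector_eq_chart_image[OF assms] by (rule connected_continuous_image)
qed

lemma sector_nonempty:
  assumes "a \<in> {1, -1}" "b \<in> {1, -1}" "c \<in> {1, -1}"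
  shows "sector a b c \<noteq> {}"
proof -
  have "chart (a, b, c, 0) \<in> sector a b c"
    using assms by (auto simp: sector_def chart_invariants)
  then show ?thesis by blast
qed

lemma open_sgn_preimage:
  fixes f :: "'a::topological_space \<Rightarrow> real"
  assumes "continuous_on UNIV f" "a \<in> {1, -1}"
  shows "open {x. sgn (f x) = a}"
proof -
  have "{x. sgn (f x) = 1} = {x. 0 < f x}" "{x. sgn (f x) = - 1} = {x. f x < 0}"
    by (simp_all only: sgn_1_pos sgn_1_neg)
  then show ?thesis
    using assms by (auto intro!: open_Collect_less)
qed

lemma continuous_invariants:
  "continuous_on UNIV gam" "continuous_on UNIV Zp" "continuous_on UNIV Zm"
proof -
  have eqs: "gam = (\<lambda>K. snd (snd (snd (snd (snd K)))))"
    "Zp = (\<lambda>K. snd (snd (snd (snd (snd K)))) * (fst K + fst (snd K) - 2 * fst (snd (snd K)))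
        - (fst (snd (snd (snd K))) - fst (snd (snd (snd (snd K)))))\<^sup>2)"
    "Zm = (\<lambda>K. snd (snd (snd (snd (snd K)))) * (fst K + fst (snd K) + 2 * fst (snd (snd K)))
        - (fst (snd (snd (snd K))) + fst (snd (snd (snd (snd K)))))\<^sup>2)"
    by auto
  show "continuous_on UNIV gam" "continuous_on UNIV Zp" "continuous_on UNIV Zm"
    unfolding eqs by (intro continuous_intros)+
qed

lemma open_sector:
  assumes "a \<in> {1, -1}" "b \<in> {1, -1}" "c \<in> {1, -1}"
  shows "open (sector a b c)"
  unfolding sector_def
  by (intro open_Collect_conj open_sgn_preimage continuous_invariants assms)

lemma nonzero_iff_sgn: "x \<noteq> 0 \<longleftrightarrow> sgn x = 1 \<or> sgn x = - 1" for x :: real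
  by (simp add: sgn_if)

lemma sector_inject:
  assumes "sector a b c \<noteq> {}"
  shows "sector a b c = sector a' b' c' \<longleftrightarrow> a = a' \<and> b = b' \<and> c = c'"
  using assms unfolding sector_def by blast

section \<open>Reflections linking the sectors\<close>

lemma involution_image:
  assumes "\<And>x. f (f x) = x"
  shows "f ` S = {x. f x \<in> S}"
proof (intro equalityI subsetI)
  fix x assume "x \<in> {x. f x \<in> S}"
  then show "x \<in> f ` S" using assms[of x] by (metis imageI mem_Collect_eq)
qed (use assms in auto)

lemma R0_image_sector: "R0 ` sector a b c = sector (- a) b c"
  unfolding involution_image[of R0, OF reflections_involutive(1)]
  unfolding sector_def mem_Collect_eq invariants_R0 sgn_minus minus_equation_iff[of "sgn _" a]
  by (simp only: eq_commute[of "- a"])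

lemma R1_image_sector: "R1 ` sector a b c = sector a c b"
  unfolding involution_image[of R1, OF reflections_involutive(2)]
  unfolding sector_def mem_Collect_eq invariants_R1
  by blast

lemma linked_refl: "linked D X X"
  unfolding linked_def by (rule exI[of _ "[]"]) simp

lemma linked_step:
  assumes "linked D X Y" "T \<in> D"
  shows "linked D X (T ` Y)"
proof -
  obtain Ts where Ts: "set Ts \<subseteq> D" and Y: "Y = foldr comp Ts id ` X"
    using assms(1) by (auto simp: linked_def)
  have "foldr comp (T # Ts) id ` X = T ` Y"
    unfolding Y by (simp add: image_image)
  moreover have "set (T # Ts) \<subseteq> D" using Ts assms(2) by simp
  ultimately show ?thesis unfolding linked_def by blast
qed

lemma linked_R0_R1:
  "linked {R0, R1} (sector a b c) (sector a b c)"
  "linked {R0, R1} (sector a b c) (sector (- a) b c)"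
  "linked {R0, R1} (sector a b c) (sector a c b)"
  "linked {R0, R1} (sector a b c) (sector (- a) c b)"
proof -
  have R0: "linked {R0, R1} X (R0 ` Y)" if "linked {R0, R1} X Y" for X Y
    by (rule linked_step[OF that]) simp
  have R1: "linked {R0, R1} X (R1 ` Y)" if "linked {R0, R1} X Y" for X Y
    by (rule linked_step[OF that]) simp
  show "linked {R0, R1} (sector a b c) (sector a b c)" by (rule linked_refl)
  show "linked {R0, R1} (sector a b c) (sector (- a) b c)"
    using R0[OF linked_refl[of _ "sector a b c"]] by (simp only: R0_image_sector)
  show "linked {R0, R1} (sector a b c) (sector a c b)"
    using R1[OF linked_refl[of _ "sector a b c"]] by (simp only: R1_image_sector)
  show "linked {R0, R1} (sector a b c) (sector (- a) c b)"
    using R0[OF R1[OF linked_refl[of _ "sector a b c"]]] by (simp only: R0_image_sector R1_image_sector)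
qed

section \<open>Components and orbits of the complement\<close>

lemma \<Gamma>_sector:
  "\<Gamma> 1 = sector 1 1 1" "\<Gamma> 2 = sector 1 1 (-1)" "\<Gamma> 3 = sector 1 (-1) 1"
  "\<Gamma> 4 = sector 1 (-1) (-1)" "\<Gamma> 5 = sector (-1) 1 1" "\<Gamma> 6 = sector (-1) 1 (-1)"
  "\<Gamma> 7 = sector (-1) (-1) 1" "\<Gamma> 8 = sector (-1) (-1) (-1)"
  by (simp_all add: \<Gamma>_def sector_def numeral_eq_Suc)

lemma indices: "{1..8} = {1, 2, 3, 4, 5, 6, 7, 8 :: nat}"
  by auto

lemma \<Gamma>_properties:
  assumes "i \<in> {1..8}"
  shows "connected (\<Gamma> i)" "open (\<Gamma> i)" "\<Gamma> i \<noteq> {}"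
  using assms unfolding indices
  by (auto simp: \<Gamma>_sector sector_nonempty simp del: One_nat_def
      intro!: connected_sector open_sector)

lemma inj_\<Gamma>: "inj_on \<Gamma> {1..8}"
  unfolding inj_on_def indices
  by (simp add: \<Gamma>_sector sector_inject sector_nonempty del: One_nat_def)

lemma disjoint_\<Gamma>: "pairwise disjnt (\<Gamma> ` {1..8})"
proof -
  have "\<Gamma> i = \<Gamma> j" if "K \<in> \<Gamma> i" "K \<in> \<Gamma> j" for i j K
    using that by (simp only: \<Gamma>_def mem_Collect_eq)
  then show ?thesis unfolding pairwise_def disjnt_iff by blast
qed

lemma Union_\<Gamma>: "\<Union> (\<Gamma> ` {1..8}) = UNIV - (S1 \<union> S2)"
proof -
  have "K \<in> \<Union> (\<Gamma> ` {1..8}) \<longleftrightarrow> K \<in> UNIV - (S1 \<union> S2)" for K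
  proof -
    have "K \<in> UNIV - (S1 \<union> S2) \<longleftrightarrow> (sgn (gam K) = 1 \<or> sgn (gam K) = - 1)
        \<and> (sgn (Zp K) = 1 \<or> sgn (Zp K) = - 1) \<and> (sgn (Zm K) = 1 \<or> sgn (Zm K) = - 1)"
      by (simp only: S1_def S2_def nonzero_iff_sgn[symmetric] Diff_iff UNIV_I Un_iff mem_Collect_eq
          mult_eq_0_iff de_Morgan_disj simp_thms)
    then show ?thesis
      unfolding indices image_insert image_empty Union_insert Union_empty \<Gamma>_sector sector_def
        Un_iff mem_Collect_eq empty_iff
      by argo
  qed
  then show ?thesis by blast
qed

lemma components_\<Gamma>: "components (UNIV - (S1 \<union> S2)) = \<Gamma> ` {1..8}"
  by (rule components_open_unique[OF disjoint_\<Gamma> Union_\<Gamma>]) (use \<Gamma>_properties in auto)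

text \<open>
  For \<open>p = m\<close> the four sectors reduce to two, which is why two of the orbits have two components
  and the third has four.
\<close>

lemma orbit_normal_form:
  assumes "p \<in> {1, -1}" "m \<in> {1, -1}"
  shows "GM_orbit (normal_form p m) = sector 1 p m \<union> sector (-1) p m \<union> sector 1 m p \<union> sector (-1) m p"
proof -
  have "normal_form p m \<notin> S1 \<union> S2" using assms by (auto simp: S1_def S2_def)
  moreover have "sgn p = p" "sgn m = m" using assms by auto
  ultimately have "GM_orbit (normal_form p m) =
      {L. (sgn (gam L) = 1 \<or> sgn (gam L) = - 1) \<and> {sgn (Zp L), sgn (Zm L)} = {p, m}}"
    by (simp add: orbit_GM sign_pair_def nonzero_iff_sgn[symmetric] del: gam.simps Zp.simps Zm.simps)
  then show ?thesis
    unfolding sector_def doubleton_eq_iff by blast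
qed

lemma orbits_GM:
  "orbits GM (UNIV - (S1 \<union> S2)) (\<lambda>g. g)
     = {\<Gamma> 1 \<union> \<Gamma> 5, \<Gamma> 4 \<union> \<Gamma> 8, \<Gamma> 2 \<union> \<Gamma> 3 \<union> \<Gamma> 6 \<union> \<Gamma> 7}"
proof -
  have orbits: "GM_orbit (normal_form 1 1) = \<Gamma> 1 \<union> \<Gamma> 5"
    "GM_orbit (normal_form (-1) (-1)) = \<Gamma> 4 \<union> \<Gamma> 8"
    "GM_orbit (normal_form 1 (-1)) = \<Gamma> 2 \<union> \<Gamma> 3 \<union> \<Gamma> 6 \<union> \<Gamma> 7"
    "GM_orbit (normal_form (-1) 1) = \<Gamma> 2 \<union> \<Gamma> 3 \<union> \<Gamma> 6 \<union> \<Gamma> 7"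
    unfolding \<Gamma>_sector by - (subst orbit_normal_form; blast)+
  have eq: "GM_orbit K = GM_orbit (normal_form (sgn (Zp K)) (sgn (Zm K)))" if "K \<notin> S1 \<union> S2" for K
  proof (intro equalityI subsetI)
    note normal = sign_normal_form[OF that]
    show "L \<in> GM_orbit (normal_form (sgn (Zp K)) (sgn (Zm K)))" if "L \<in> GM_orbit K" for L
      using GM_orbit_sym[OF normal] that by (rule GM_orbit_trans)
    show "L \<in> GM_orbit K" if "L \<in> GM_orbit (normal_form (sgn (Zp K)) (sgn (Zm K)))" for L
      using normal that by (rule GM_orbit_trans)
  qed
  have "GM_orbit K \<in> {\<Gamma> 1 \<union> \<Gamma> 5, \<Gamma> 4 \<union> \<Gamma> 8, \<Gamma> 2 \<union> \<Gamma> 3 \<union> \<Gamma> 6 \<union> \<Gamma> 7}" if "K \<notin> S1 \<union> S2" for K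
  proof -
    have "sgn (Zp K) = 1 \<or> sgn (Zp K) = - 1" "sgn (Zm K) = 1 \<or> sgn (Zm K) = - 1"
      using that by (simp_all add: S2_def nonzero_iff_sgn[symmetric])
    then show ?thesis
      by (elim disjE; simp only: eq[OF that] orbits insert_iff simp_thms)
  qed
  then have "orbits GM (UNIV - (S1 \<union> S2)) (\<lambda>g. g)
      \<subseteq> {\<Gamma> 1 \<union> \<Gamma> 5, \<Gamma> 4 \<union> \<Gamma> 8, \<Gamma> 2 \<union> \<Gamma> 3 \<union> \<Gamma> 6 \<union> \<Gamma> 7}"
    unfolding orbits_def by blast
  moreover have "GM_orbit (normal_form p m) \<in> orbits GM (UNIV - (S1 \<union> S2)) (\<lambda>g. g)"
    if "p \<noteq> 0" "m \<noteq> 0" for p m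
  proof -
    have "normal_form p m \<in> UNIV - (S1 \<union> S2)" using that by (simp add: S1_def S2_def)
    then show ?thesis unfolding orbits_def by blast
  qed
  from this[of 1 1] this[of "-1" "-1"] this[of 1 "-1"]
  have "{\<Gamma> 1 \<union> \<Gamma> 5, \<Gamma> 4 \<union> \<Gamma> 8, \<Gamma> 2 \<union> \<Gamma> 3 \<union> \<Gamma> 6 \<union> \<Gamma> 7} \<subseteq> orbits GM (UNIV - (S1 \<union> S2)) (\<lambda>g. g)"
    unfolding orbits by simp
  ultimately show ?thesis by (rule equalityI)
qed

lemma card_orbits_GM:
  "card {\<Gamma> 1 \<union> \<Gamma> 5, \<Gamma> 4 \<union> \<Gamma> 8, \<Gamma> 2 \<union> \<Gamma> 3 \<union> \<Gamma> 6 \<union> \<Gamma> 7} = 3"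
proof -
  have "normal_form 1 1 \<in> \<Gamma> 1 \<union> \<Gamma> 5" "normal_form 1 1 \<notin> \<Gamma> 4 \<union> \<Gamma> 8"
    "normal_form 1 1 \<notin> \<Gamma> 2 \<union> \<Gamma> 3 \<union> \<Gamma> 6 \<union> \<Gamma> 7"
    "normal_form (-1) (-1) \<in> \<Gamma> 4 \<union> \<Gamma> 8"
    "normal_form (-1) (-1) \<notin> \<Gamma> 2 \<union> \<Gamma> 3 \<union> \<Gamma> 6 \<union> \<Gamma> 7"
    unfolding \<Gamma>_sector by (auto simp: sector_def)
  then have "\<Gamma> 1 \<union> \<Gamma> 5 \<noteq> \<Gamma> 4 \<union> \<Gamma> 8" "\<Gamma> 1 \<union> \<Gamma> 5 \<noteq> \<Gamma> 2 \<union> \<Gamma> 3 \<union> \<Gamma> 6 \<union> \<Gamma> 7"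
    "\<Gamma> 4 \<union> \<Gamma> 8 \<noteq> \<Gamma> 2 \<union> \<Gamma> 3 \<union> \<Gamma> 6 \<union> \<Gamma> 7"
    by metis+
  then show ?thesis by simp
qed

theorem proposition20:
  shows "(\<forall>i\<in>{1..8}. connected (\<Gamma> i))
    \<and> components (UNIV - (S1 \<union> S2)) = \<Gamma> ` {1..8}
    \<and> card (components (UNIV - (S1 \<union> S2))) = 8
    \<and> orbits GM (UNIV - (S1 \<union> S2)) (\<lambda>g. g)
        = {\<Gamma> 1 \<union> \<Gamma> 5, \<Gamma> 4 \<union> \<Gamma> 8, \<Gamma> 2 \<union> \<Gamma> 3 \<union> \<Gamma> 6 \<union> \<Gamma> 7}
    \<and> card (orbits GM (UNIV - (S1 \<union> S2)) (\<lambda>g. g)) = 3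
    \<and> linked {R0} (\<Gamma> 1) (\<Gamma> 5)
    \<and> linked {R0} (\<Gamma> 4) (\<Gamma> 8)
    \<and> (\<forall>X\<in>{\<Gamma> 2, \<Gamma> 3, \<Gamma> 6, \<Gamma> 7}. \<forall>Y\<in>{\<Gamma> 2, \<Gamma> 3, \<Gamma> 6, \<Gamma> 7}. linked {R0, R1} X Y)"
proof -
  have "card (components (UNIV - (S1 \<union> S2))) = 8"
    unfolding components_\<Gamma> card_image[OF inj_\<Gamma>] by simp
  moreover have "linked {R0} (\<Gamma> 1) (\<Gamma> 5)" "linked {R0} (\<Gamma> 4) (\<Gamma> 8)"
    unfolding \<Gamma>_sector R0_image_sector[symmetric] by (rule linked_step[OF linked_refl singletonI])+
  moreover have "\<forall>X\<in>{\<Gamma> 2, \<Gamma> 3, \<Gamma> 6, \<Gamma> 7}. \<forall>Y\<in>{\<Gamma> 2, \<Gamma> 3, \<Gamma> 6, \<Gamma> 7}. linked {R0, R1} X Y"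
    unfolding \<Gamma>_sector
    using linked_R0_R1[of 1 1 "-1"] linked_R0_R1[of 1 "-1" 1]
      linked_R0_R1[of "-1" 1 "-1"] linked_R0_R1[of "-1" "-1" 1]
    by simp
  ultimately show ?thesis
    using \<Gamma>_properties(1) components_\<Gamma> orbits_GM card_orbits_GM by simp
qed

end
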